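(* Let $U(x,q)=\sum_{n\ge1}x^n\sum_{w\in\mathcal{M}_n}q^{\mathrm{area}(w)}$ be the generating function for the number of nonempty Motzkin polyominoes according to the length and the area. Then $$U(x,q)=\frac{\displaystyle\sum_{j\geq1}(-1)^{j-1}q^{j}x^j\prod_{i=1}^{j-1}\frac{1-q^i+q^{2i}}{1-q^i}} {1-\displaystyle\sum_{j\geq1}(-1)^{j-1}\frac{q^{j}x^j}{1-q^j}\prod_{i=1}^{j-1}\frac{1-q^i+q^{2i}}{1-q^i}}.$$
   Context: A Motzkin word of length $n\ge 1$ is a word $w=w_1\cdots w_n$ over the positive integers such that $w_1=1$, and $1\le w_k\le w_{k-1}+1$ and $w_{k-1}\ne w_k$ for $k=2,\dots,n$; $\mathcal{M}_n$ is the set of Motzkin words of length $n$. To $w$ one associates the Motzkin polyomino $P(w)$ of length $n$ with $n$ columns, all bottom-justified, whose $i$-th column consists of $w_i$ unit cells. $\mathrm{area}(w)$ is the number of cells of $P(w)$, i.e. $w_1+\cdots+w_n$. The identity is between formal power series in $x$ and $q$ (each $1/(1-q^i)$ expanded as a geometric series). *)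

theory Defs
  imports "HOL-Computational_Algebra.Formal_Power_Series"
begin

definition motzkin_words :: "nat \<Rightarrow> nat list set" where
  "motzkin_words n =
     {w. length w = n \<and> n \<ge> 1 \<and> w ! 0 = 1 \<and>
         (\<forall>k\<in>{1..<n}. 1 \<le> w ! k \<and> w ! k \<le> w ! (k - 1) + 1 \<and> w ! (k - 1) \<noteq> w ! k)}"

text \<open>The unit cell in column \<open>i\<close> and row \<open>r\<close>, both counted from 1, is represented by the
  pair \<open>(i, r)\<close>.\<close>

definition polyomino :: "nat list \<Rightarrow> (nat \<times> nat) set" where
  "polyomino w = {(i, r). 1 \<le> i \<and> i \<le> length w \<and> 1 \<le> r \<and> r \<le> w ! (i - 1)}"

definition area :: "nat list \<Rightarrow> nat" where
  "area w = card (polyomino w)"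

text \<open>Power series in \<open>x\<close> and \<open>q\<close> are power series in \<open>x\<close> whose coefficients are power series
  in \<open>q\<close> over the rationals; here \<open>q\<close> is the indeterminate of the coefficient ring.\<close>

abbreviation q :: "rat fps" where
  "q \<equiv> fps_X"

definition motzkin_gf :: "rat fps fps" where
  "motzkin_gf = Abs_fps (\<lambda>n. if n = 0 then 0 else \<Sum>w\<in>motzkin_words n. q ^ area w)"

lemma area_eq_sum_list: "area w = sum_list w"
proof -
  have "polyomino w = (SIGMA i:{1..length w}. {1..w ! (i - 1)})"
    by (auto simp: polyomino_def)
  then have "area w = (\<Sum>i=1..length w. w ! (i - 1))"
    by (simp add: area_def)
  also have "\<dots> = (\<Sum>i<length w. w ! i)"
    by (rule sum.reindex_bij_witness[of _ Suc "\<lambda>i. i - 1"]) auto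
  finally show ?thesis
    by (simp add: sum_list_sum_nth atLeast0LessThan)
qed

lemma finite_motzkin_words: "finite (motzkin_words n)"
proof (rule finite_subset)
  show "motzkin_words n \<subseteq> {w. set w \<subseteq> {..n} \<and> length w = n}"
  proof
    fix w assume w: "w \<in> motzkin_words n"
    have "w ! k \<le> k + 1" if "k < n" for k
      using that
    proof (induction k)
      case (Suc k)
      have "\<forall>k\<in>{1..<n}. w ! k \<le> w ! (k - 1) + 1"
        using w by (simp add: motzkin_words_def)
      then have "w ! Suc k \<le> w ! (Suc k - 1) + 1"
        by (rule bspec) (use Suc.prems in simp)
      with Suc show ?case by simp
    qed (use w in \<open>simp add: motzkin_words_def\<close>)
    then show "w \<in> {w. set w \<subseteq> {..n} \<and> length w = n}"
      using w by (fastforce simp: motzkin_words_def in_set_conv_nth)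
  qed
qed (simp add: finite_lists_length_eq)

text \<open>The ring of coefficients \<open>rat fps\<close> is not a field, but a series with constant
  coefficient 1 is invertible, and division by it is genuine division.\<close>

lemma divide_fps_fps_mult_cancel:
  fixes f g :: "rat fps fps"
  assumes "fps_nth g 0 = 1"
  shows "f / g * g = f"
proof -
  have "inverse g * g = 1"
    using fps_right_inverse[of g 1] assms
    by (simp add: fps_inverse_def[of g] mult.commute)
  moreover have "subdegree g = 0" "g \<noteq> 0"
    using assms by (auto simp: subdegree_eq_0_iff)
  ultimately show ?thesis
    by (simp add: fps_divide_def mult.assoc)
qed

end

theory Submission
  imports Defs
begin

text \<open>The proof refines the generating function by the last letter of the word, weighting a word
  \<open>w\<close> by \<open>q ^ (area w + m * last w)\<close>; call the resulting series \<open>F m\<close> (\<open>last_letter_gf\<close>), so that \<open>F 0\<close> is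
  the generating function in question. Here \<open>q ^ m\<close> plays the role of a catalytic variable.

  A word ending in \<open>a\<close> can be extended exactly by the letters \<open>1, \<dots>, a + 1\<close> other than \<open>a\<close>.
  Summing the geometric series over these letters, with \<open>Q = q ^ (m + 1)\<close>, gives
  \[ F_m = x \Bigl( Q + \frac{Q}{1-Q} F_0 - \frac{1-Q+Q^2}{1-Q} F_{m+1} \Bigr), \]
  because the sum over the new letter is \<open>Q / (1 - Q)\<close> minus a multiple of \<open>Q ^ a\<close>, and the
  factor \<open>Q ^ a\<close> turns \<open>F 0\<close> into \<open>F (m + 1)\<close> (\<open>sum_next_letters\<close>,
  \<open>last_letter_gf_rec\<close>). Unrolling this recursion in \<open>m\<close> produces alternating
  sums of products. The two sums of the theorem have shifted versions, for each \<open>m\<close>, whose first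
  summand splits off in the same way (\<open>alternating_series_rec\<close>). The difference between
  \<open>F m\<close> and the combination of the shifted sums then solves a homogeneous recursion, in which each
  step gains a factor \<open>x\<close>, and so it vanishes (\<open>homogeneous_recursion_zero\<close>). For
  \<open>m = 0\<close> this is a linear equation for \<open>F 0\<close>.\<close>

lemma motzkin_words_1: "motzkin_words (Suc 0) = {[1]}"
  by (auto simp: motzkin_words_def length_Suc_conv)

lemma last_motzkin_word_pos:
  assumes "w \<in> motzkin_words n"
  shows "w \<noteq> []" and "1 \<le> last w"
proof -
  show "w \<noteq> []"
    using assms by (auto simp: motzkin_words_def)
  show "1 \<le> last w"
  proof (cases "n = 1")
    case True
    with assms show ?thesis by (simp add: motzkin_words_1)
  next
    case False
    with assms have "n - 1 \<in> {1..<n}" "length w = n"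
      by (auto simp: motzkin_words_def)
    with assms \<open>w \<noteq> []\<close> show ?thesis
      by (auto simp: motzkin_words_def last_conv_nth)
  qed
qed

lemma append_letter_in_motzkin_words_iff:
  assumes "n \<ge> 1"
  shows "w @ [b] \<in> motzkin_words (Suc n) \<longleftrightarrow>
    w \<in> motzkin_words n \<and> b \<in> {1..last w + 1} - {last w}"
proof (cases "length w = n")
  case True
  with assms have "w \<noteq> []"
    by auto
  with True have last: "w ! (n - 1) = last w"
    by (simp add: last_conv_nth)
  have split: "{1..<Suc n} = insert n {1..<n}"
    using assms by auto
  have "(w @ [b]) ! k = w ! k" "(w @ [b]) ! (k - 1) = w ! (k - 1)" if "k \<in> {1..<n}" for k
    using True that by (auto simp: nth_append)
  moreover have "(w @ [b]) ! n = b" "(w @ [b]) ! (n - 1) = last w" "(w @ [b]) ! 0 = w ! 0"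
    using True assms last by (auto simp: nth_append)
  ultimately show ?thesis
    using True assms unfolding motzkin_words_def split
    by (simp cong: ball_cong) auto
qed (auto simp: motzkin_words_def)

lemma motzkin_words_Suc:
  assumes "n \<ge> 1"
  shows "motzkin_words (Suc n) =
    (\<lambda>(w, b). w @ [b]) ` (SIGMA w:motzkin_words n. {1..last w + 1} - {last w})"
proof -
  have "w \<noteq> []" if "w \<in> motzkin_words (Suc n)" for w
    using last_motzkin_word_pos(1)[OF that] .
  moreover have "butlast w @ [last w] = w" if "w \<noteq> []" for w :: "nat list"
    using that by simp
  ultimately have "w \<in> (\<lambda>(w, b). w @ [b]) ` (SIGMA w:motzkin_words n. {1..last w + 1} - {last w})"
    if "w \<in> motzkin_words (Suc n)" for w
    using that append_letter_in_motzkin_words_iff[OF assms, of "butlast w" "last w"]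
    by (intro image_eqI[of _ _ "(butlast w, last w)"]) auto
  then show ?thesis
    using append_letter_in_motzkin_words_iff[OF assms] by auto
qed

text \<open>In terms of \<open>Q = q ^ k\<close>, these are the two coefficients of the recursion in the overview.\<close>

definition kernel_ratio :: "nat \<Rightarrow> rat fps" where
  "kernel_ratio k = (1 - q ^ k + q ^ (2 * k)) / (1 - q ^ k)"

definition geometric_ratio :: "nat \<Rightarrow> rat fps" where
  "geometric_ratio k = q ^ k / (1 - q ^ k)"

lemma divide_one_minus_q_power:
  assumes "k \<ge> 1"
  shows "f / (1 - q ^ k) * (1 - q ^ k) = f"
proof -
  have "fps_nth (1 - q ^ k) 0 \<noteq> 0"
    using assms by simp
  then show ?thesis
    by (simp add: fps_divide_unit mult.assoc inverse_mult_eq_1)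
qed

text \<open>The letters that may follow \<open>a\<close> form an interval with one gap. Their geometric sum is an
  affine function of \<open>q ^ (k * a)\<close>, and this is what closes the recursion.\<close>

lemma sum_next_letters:
  assumes "k \<ge> 1" and "a \<ge> 1"
  shows "(\<Sum>b\<in>{1..a + 1} - {a}. q ^ (k * b)) =
    geometric_ratio k - kernel_ratio k * q ^ (k * a)"
proof -
  define Q where "Q = q ^ k"
  have nonzero: "1 - Q \<noteq> 0"
  proof
    assume "1 - Q = 0"
    then have "fps_nth (1 - Q) 0 = 0" by simp
    with assms show False by (simp add: Q_def)
  qed
  have "(\<Sum>b\<in>{1..a + 1} - {a}. Q ^ b) = (\<Sum>b=1..a + 1. Q ^ b) - Q ^ a"
    using assms by (simp add: sum_diff1)
  then have "(1 - Q) * (\<Sum>b\<in>{1..a + 1} - {a}. Q ^ b) = Q - Q ^ (a + 2) - (1 - Q) * Q ^ a"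
    using sum_gp_multiplied[of 1 "a + 1" Q] by (simp add: right_diff_distrib del: sum.cl_ivl_Suc)
  also have "\<dots> = Q - (1 - Q + Q ^ 2) * Q ^ a"
    by (simp add: algebra_simps power2_eq_square)
  also have "\<dots> = (1 - Q) * (geometric_ratio k - kernel_ratio k * Q ^ a)"
  proof -
    have "geometric_ratio k * (1 - Q) = Q" "kernel_ratio k * (1 - Q) = 1 - Q + Q ^ 2"
      using divide_one_minus_q_power[OF assms(1)]
      by (simp_all add: geometric_ratio_def kernel_ratio_def Q_def power_mult[symmetric] mult.commute)
    then show ?thesis
      by (metis (no_types, lifting) mult.assoc mult.commute right_diff_distrib)
  qed
  finally show ?thesis
    using nonzero by (simp add: Q_def power_mult)
qed

text \<open>The usual catalytic variable for the last letter is specialised to \<open>q ^ m\<close>. The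
  recursion only ever substitutes such powers for it, and all series stay in the ring of the
  theorem.\<close>

definition last_letter_gf :: "nat \<Rightarrow> rat fps fps" where
  "last_letter_gf m = Abs_fps (\<lambda>n. \<Sum>w\<in>motzkin_words n. q ^ (sum_list w + m * last w))"

lemma motzkin_words_0: "motzkin_words 0 = {}"
  by (simp add: motzkin_words_def)

lemma motzkin_gf_eq_last_letter_gf: "motzkin_gf = last_letter_gf 0"
  by (rule fps_ext)
     (simp add: motzkin_gf_def last_letter_gf_def area_eq_sum_list motzkin_words_0)

text \<open>The new last letter \<open>b\<close> is counted once in the area and \<open>m\<close> times in the refinement, so
  that \<open>w @ [b]\<close> has weight \<open>q ^ sum_list w * q ^ ((m + 1) * b)\<close>. By \<open>sum_next_letters\<close>,
  summing over \<open>b\<close> leaves weights of \<open>w\<close> with parameters \<open>0\<close> and \<open>m + 1\<close>. The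
  one-letter word accounts for the inhomogeneous term.\<close>

lemma last_letter_gf_rec:
  "last_letter_gf m = fps_X * (fps_const (q ^ Suc m) +
     fps_const (geometric_ratio (Suc m)) * last_letter_gf 0 -
     fps_const (kernel_ratio (Suc m)) * last_letter_gf (Suc m))"
proof (rule fps_ext)
  fix n
  let ?k = "Suc m"
  show "fps_nth (last_letter_gf m) n = fps_nth (fps_X * (fps_const (q ^ ?k) +
     fps_const (geometric_ratio ?k) * last_letter_gf 0 -
     fps_const (kernel_ratio ?k) * last_letter_gf ?k)) n"
  proof (cases "n \<le> 1")
    case True
    then consider "n = 0" | "n = 1" by linarith
    then show ?thesis
      by cases (simp_all add: last_letter_gf_def motzkin_words_0 motzkin_words_1)
  next
    case False
    then obtain l where n: "n = Suc l" and l: "l \<ge> 1"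
      by (cases n) auto
    have inj: "inj_on (\<lambda>(w, b). w @ [b]) A" for A :: "(nat list \<times> nat) set"
      by (auto simp: inj_on_def)
    have "fps_nth (last_letter_gf m) n =
        (\<Sum>w\<in>motzkin_words (Suc l). q ^ (sum_list w + m * last w))"
      by (simp add: last_letter_gf_def n)
    also have "\<dots> = (\<Sum>w\<in>motzkin_words l. \<Sum>b\<in>{1..last w + 1} - {last w}. q ^ (sum_list w + ?k * b))"
      unfolding motzkin_words_Suc[OF l]
      by (subst sum.reindex[OF inj]) (simp add: sum.Sigma finite_motzkin_words case_prod_unfold add_ac)
    also have "\<dots> = (\<Sum>w\<in>motzkin_words l.
        q ^ sum_list w * (geometric_ratio ?k - kernel_ratio ?k * q ^ (?k * last w)))"
    proof (rule sum.cong)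
      fix w assume "w \<in> motzkin_words l"
      then have "last w \<ge> 1"
        by (rule last_motzkin_word_pos)
      with sum_next_letters[of ?k "last w"]
      show "(\<Sum>b\<in>{1..last w + 1} - {last w}. q ^ (sum_list w + ?k * b)) =
          q ^ sum_list w * (geometric_ratio ?k - kernel_ratio ?k * q ^ (?k * last w))"
        by (simp only: power_add sum_distrib_left[symmetric])
    qed simp
    also have "\<dots> = geometric_ratio ?k * fps_nth (last_letter_gf 0) l -
        kernel_ratio ?k * fps_nth (last_letter_gf ?k) l"
      by (simp add: last_letter_gf_def sum_distrib_left right_diff_distrib sum_subtractf
          power_add mult_ac)
    finally show ?thesis
      using l by (simp add: n)
  qed
qed

text \<open>With \<open>m = 0\<close> this is the shape of both sums in the theorem: \<open>c k = q ^ k\<close> gives the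
  numerator and \<open>c = geometric_ratio\<close> the sum in the denominator. The shift \<open>m\<close> makes them
  unrollable.\<close>

definition alternating_series :: "(nat \<Rightarrow> rat fps) \<Rightarrow> nat \<Rightarrow> rat fps fps" where
  "alternating_series c m = Abs_fps (\<lambda>j. if j = 0 then 0 else
     (-1) ^ (j - 1) * c (m + j) * (\<Prod>i=1..j - 1. kernel_ratio (m + i)))"

lemma alternating_series_rec:
  "alternating_series c m =
    fps_X * (fps_const (c (Suc m)) - fps_const (kernel_ratio (Suc m)) * alternating_series c (Suc m))"
proof (rule fps_ext)
  fix n
  show "fps_nth (alternating_series c m) n = fps_nth (fps_X * (fps_const (c (Suc m)) -
    fps_const (kernel_ratio (Suc m)) * alternating_series c (Suc m))) n"
  proof (cases "n \<le> 1")
    case True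
    then consider "n = 0" | "n = 1" by linarith
    then show ?thesis
      by cases (simp_all add: alternating_series_def)
  next
    case False
    then obtain l where n: "n = Suc (Suc l)"
      by (metis One_nat_def le_SucI le_refl nat.exhaust not0_implies_Suc zero_le)
    have "(\<Prod>i=1..Suc l. kernel_ratio (m + i)) =
        kernel_ratio (Suc m) * (\<Prod>i=1..l. kernel_ratio (Suc m + i))"
      by (simp add: prod.atLeast_Suc_atMost prod.shift_bounds_cl_Suc_ivl del: prod.cl_ivl_Suc)
    then show ?thesis
      by (simp add: alternating_series_def n mult_ac del: prod.cl_ivl_Suc)
  qed
qed

text \<open>Iterating the recursion \<open>n + 1\<close> times exhibits a factor \<open>x ^ (n + 1)\<close>, so no coefficient
  survives.\<close>

lemma homogeneous_recursion_zero:
  fixes E :: "nat \<Rightarrow> 'a::comm_ring_1 fps"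
  assumes rec: "\<And>m. E m = fps_X * (r m * E (Suc m))"
  shows "E m = 0"
proof -
  have "\<forall>i\<le>n. fps_nth (E m) i = 0" for n
  proof (induction n arbitrary: m)
    case 0
    show ?case by (subst rec) simp
  next
    case (Suc n)
    show ?case
    proof (intro allI impI)
      fix i assume "i \<le> Suc n"
      then have "fps_nth (r m * E (Suc m)) (i - 1) = 0"
        using Suc.IH[of "Suc m"] by (auto simp: fps_mult_nth intro!: sum.neutral)
      then show "fps_nth (E m) i = 0"
        by (subst rec) simp
    qed
  qed
  then show ?thesis
    by (auto simp: fps_eq_iff)
qed

text \<open>Both sides satisfy the same recursion in \<open>m\<close>: the sum for \<open>q ^ k\<close> absorbs the
  constant term, and the sum for \<open>geometric_ratio\<close> absorbs the multiple of \<open>F 0\<close>, which does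
  not change with \<open>m\<close>.\<close>

lemma last_letter_gf_eq_alternating_series:
  "last_letter_gf m = alternating_series (\<lambda>k. q ^ k) m +
     alternating_series geometric_ratio m * last_letter_gf 0"
proof -
  define E where "E m = last_letter_gf m - alternating_series (\<lambda>k. q ^ k) m -
     alternating_series geometric_ratio m * last_letter_gf 0" for m
  have "E m = fps_X * (- fps_const (kernel_ratio (Suc m)) * E (Suc m))" for m
    unfolding E_def
    by (subst last_letter_gf_rec[of m], subst (1 2) alternating_series_rec[of _ m])
       (simp add: algebra_simps del: fps_const_neg)
  then have "E m = 0"
    by (rule homogeneous_recursion_zero)
  then show ?thesis
    by (simp add: E_def algebra_simps)
qed

theorem theorem5p1:
  shows "motzkin_gf =
    Abs_fps (\<lambda>j. if j = 0 then 0 else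
        (-1) ^ (j - 1) * q ^ j * (\<Prod>i=1..j - 1. (1 - q ^ i + q ^ (2 * i)) / (1 - q ^ i))) /
    (1 - Abs_fps (\<lambda>j. if j = 0 then 0 else
        (-1) ^ (j - 1) * (q ^ j / (1 - q ^ j)) *
        (\<Prod>i=1..j - 1. (1 - q ^ i + q ^ (2 * i)) / (1 - q ^ i))))"
proof -
  define N where "N = alternating_series (\<lambda>k. q ^ k) 0"
  define D where "D = alternating_series geometric_ratio 0"
  have "fps_nth (1 - D) 0 = 1"
    by (simp add: D_def alternating_series_def)
  then have "N / (1 - D) * (1 - D) = N" and "1 - D \<noteq> 0"
    by (auto intro: divide_fps_fps_mult_cancel simp del: fps_sub_nth)
  moreover have "motzkin_gf * (1 - D) = N"
    using last_letter_gf_eq_alternating_series[of 0]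
    by (simp add: motzkin_gf_eq_last_letter_gf N_def D_def algebra_simps)
  ultimately have "motzkin_gf = N / (1 - D)"
    by (metis mult_right_cancel)
  then show ?thesis
    by (simp only: N_def D_def add_0 alternating_series_def kernel_ratio_def geometric_ratio_def)
qed

end
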